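(* For every $n\ge5$ the map $G':\mathcal M'\to Q$ defined in the context is bijective.
   Context: Let $n\ge5$ and $I=\{1,\dots,n\}$. For $n$ odd let $I_0$ be the set of even and $I_1$ the set of odd elements of $I$; for $n$ even let $I_0$ be the set of odd and $I_1$ the set of even elements of $I$. Let $V=\{(i,1),(i,3):i\in I_0\}\cup\{(j,2),(j,4):j\in I_1\}\cup\{(n-1,5)\}\cup\{(2,5)\}$ if $n$ is odd, and the same with $(2,5)$ replaced by $(2,0)$ if $n$ is even. Let $i_a$ ($(i,a)\in V$) be commuting indeterminates and $\mathcal M$ the set of monomials (nonnegative exponents) in them. Put $(A,B,C)=(2_1,2_3,2_5)$ if $n$ is odd and $(A,B,C)=(2_4,2_2,2_0)$ if $n$ is even; $(A',B',C')=((n-1)_1,(n-1)_3,(n-1)_5)$. Put $F_2=ABC$, $F_{n-1}=A'B'C'$, and for $i\in I\setminus\{2,n-1\}$, $F_i=i_1i_3$ if $i\in I_0$, $F_i=i_2i_4$ if $i\in I_1$. $\mathcal M'\subset\mathcal M$ is the set of monomials not divisible by any $F_i$, $i\in I$. Let $Q=\bigoplus_{i=0}^{n+1}\mathbb Z\alpha_i$ (the root lattice of $D_{n+1}^{(1)}$). Every $m\in\mathcal M$ has a unique expression with nonnegative integer exponents $$m=\prod_{i\in I}F_i^{a_i}\prod_{i\in I_0\setminus\{2,n-1\}}i_3^{p_i}i_1^{q_i}\prod_{j\in I_1\setminus\{2\}}j_2^{p_j}j_4^{q_j}\cdot(BC)^p(AC)^q(AB)^rA^sB^tC^u\cdot(B'C')^{p'}(A'C')^{q'}(A'B')^{r'}{A'}^{s'}{B'}^{t'}{C'}^{u'}$$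 such that each of the tuples $(p_i,q_i)$ ($i\in I\setminus\{2,n-1\}$), $(p,q,r)$, $(s,t,u)$, $(p,s)$, $(q,t)$, $(r,u)$, $(p',q',r')$, $(s',t',u')$, $(p',s')$, $(q',t')$, $(r',u')$ has at most one nonzero entry. Define $G:\mathcal M\to Q$ by \begin{align*}G(m)=&\sum_{i\in I\setminus\{2,n-1\}}(q_i-p_i)\alpha_i-p\alpha_0+q(\alpha_0+\alpha_1+2\alpha_2+\alpha_3)+r\alpha_0+s(\alpha_0+\alpha_2)-t\alpha_2+u(\alpha_1+\alpha_2+\alpha_3)\\&-p'\alpha_{n+1}+q'(\alpha_{n-2}+2\alpha_{n-1}+\alpha_n+\alpha_{n+1})+r'\alpha_{n+1}+s'(\alpha_{n-1}+\alpha_{n+1})-t'\alpha_{n-1}+u'(\alpha_{n-2}+\alpha_{n-1}+\alpha_n).\end{align*} Let $G'$ be the restriction of $G$ to $\mathcal M'$. *)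

theory Defs
  imports "HOL-Library.Multiset" "HOL-Library.FuncSet" "HOL-Library.Poly_Mapping"
begin

text \<open>
  The indeterminate \<open>i\<^sub>a\<close> is the pair \<open>(i, a)\<close>.  A monomial is the multiset of its indeterminates:
  the product of monomials is \<open>+\<close>, the power \<open>m\<^sup>k\<close> is \<open>repeat_mset k m\<close>, divisibility is \<open>\<subseteq>#\<close>.
\<close>

type_synonym indet = "nat \<times> nat"
type_synonym monomial = "indet multiset"

definition I :: "nat \<Rightarrow> nat set" where
  "I n = {1..n}"

definition I0 :: "nat \<Rightarrow> nat set" where
  "I0 n = (if odd n then {i \<in> I n. even i} else {i \<in> I n. odd i})"

definition I1 :: "nat \<Rightarrow> nat set" where
  "I1 n = (if odd n then {i \<in> I n. odd i} else {i \<in> I n. even i})"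

definition V :: "nat \<Rightarrow> indet set" where
  "V n = (\<Union>i \<in> I0 n. {(i, 1), (i, 3)}) \<union> (\<Union>j \<in> I1 n. {(j, 2), (j, 4)})
         \<union> {(n - 1, 5)} \<union> (if odd n then {(2, 5)} else {(2, 0)})"

definition monomials :: "nat \<Rightarrow> monomial set" where
  "monomials n = {m. set_mset m \<subseteq> V n}"

definition varA :: "nat \<Rightarrow> indet" where "varA n = (if odd n then (2, 1) else (2, 4))"
definition varB :: "nat \<Rightarrow> indet" where "varB n = (if odd n then (2, 3) else (2, 2))"
definition varC :: "nat \<Rightarrow> indet" where "varC n = (if odd n then (2, 5) else (2, 0))"

definition varA' :: "nat \<Rightarrow> indet" where "varA' n = (n - 1, 1)"
definition varB' :: "nat \<Rightarrow> indet" where "varB' n = (n - 1, 3)"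
definition varC' :: "nat \<Rightarrow> indet" where "varC' n = (n - 1, 5)"

definition F :: "nat \<Rightarrow> nat \<Rightarrow> monomial" where
  "F n i = (if i = 2 then {#varA n, varB n, varC n#}
            else if i = n - 1 then {#varA' n, varB' n, varC' n#}
            else if i \<in> I0 n then {#(i, 1), (i, 3)#}
            else {#(i, 2), (i, 4)#})"

definition reduced_monomials :: "nat \<Rightarrow> monomial set" where
  "reduced_monomials n = {m \<in> monomials n. \<forall>i \<in> I n. \<not> F n i \<subseteq># m}"

definition at_most_one_nonzero :: "nat list \<Rightarrow> bool" where
  "at_most_one_nonzero xs \<longleftrightarrow> length (filter (\<lambda>x. x \<noteq> 0) xs) \<le> 1"

text \<open>
  The exponents attached to a trivalent vertex (\<open>2\<close> or \<open>n - 1\<close>) with indeterminates \<open>a\<close>, \<open>b\<close>, \<open>c\<close>: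
  \<open>(bc)\<^sup>p (ac)\<^sup>q (ab)\<^sup>r a\<^sup>s b\<^sup>t c\<^sup>u\<close>.
\<close>

record trivalent_exps =
  tp :: nat
  tq :: nat
  tr :: nat
  ts :: nat
  tt :: nat
  tu :: nat

definition trivalent_monomial :: "indet \<Rightarrow> indet \<Rightarrow> indet \<Rightarrow> trivalent_exps \<Rightarrow> monomial" where
  "trivalent_monomial a b c x =
     repeat_mset (tp x) {#b, c#} + repeat_mset (tq x) {#a, c#} + repeat_mset (tr x) {#a, b#}
     + repeat_mset (ts x) {#a#} + repeat_mset (tt x) {#b#} + repeat_mset (tu x) {#c#}"

definition trivalent_ok :: "trivalent_exps \<Rightarrow> bool" where
  "trivalent_ok x \<longleftrightarrow>
     at_most_one_nonzero [tp x, tq x, tr x] \<and> at_most_one_nonzero [ts x, tt x, tu x]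
     \<and> at_most_one_nonzero [tp x, ts x] \<and> at_most_one_nonzero [tq x, tt x]
     \<and> at_most_one_nonzero [tr x, tu x]"

text \<open>
  The exponent families \<open>a\<^sub>i\<close>, \<open>p\<^sub>i\<close>, \<open>q\<^sub>i\<close>, and the exponents at the vertices \<open>2\<close> (unprimed)
  and \<open>n - 1\<close> (primed).
\<close>

record exps =
  fa :: "nat \<Rightarrow> nat"
  fp :: "nat \<Rightarrow> nat"
  fq :: "nat \<Rightarrow> nat"
  vL :: trivalent_exps
  vR :: trivalent_exps

definition exps_monomial :: "nat \<Rightarrow> exps \<Rightarrow> monomial" where
  "exps_monomial n e =
     (\<Sum>i \<in> I n. repeat_mset (fa e i) (F n i))
     + (\<Sum>i \<in> I0 n - {2, n - 1}. repeat_mset (fp e i) {#(i, 3)#} + repeat_mset (fq e i) {#(i, 1)#})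
     + (\<Sum>j \<in> I1 n - {2}. repeat_mset (fp e j) {#(j, 2)#} + repeat_mset (fq e j) {#(j, 4)#})
     + trivalent_monomial (varA n) (varB n) (varC n) (vL e)
     + trivalent_monomial (varA' n) (varB' n) (varC' n) (vR e)"

text \<open>
  The families are indexed by proper subsets of \<open>nat\<close>; they are set to zero off their index sets, so
  that the expression of a monomial is unique.
\<close>

definition exps_ok :: "nat \<Rightarrow> exps \<Rightarrow> bool" where
  "exps_ok n e \<longleftrightarrow>
     (\<forall>i. i \<notin> I n \<longrightarrow> fa e i = 0)
     \<and> (\<forall>i. i \<notin> I n - {2, n - 1} \<longrightarrow> fp e i = 0 \<and> fq e i = 0)
     \<and> (\<forall>i \<in> I n - {2, n - 1}. at_most_one_nonzero [fp e i, fq e i])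
     \<and> trivalent_ok (vL e) \<and> trivalent_ok (vR e)"

definition expresses :: "nat \<Rightarrow> monomial \<Rightarrow> exps \<Rightarrow> bool" where
  "expresses n m e \<longleftrightarrow> exps_ok n e \<and> m = exps_monomial n e"

text \<open>The free abelian group on \<open>\<alpha>\<^sub>0, \<dots>, \<alpha>\<^sub>n\<^sub>+\<^sub>1\<close>, inside the finitely supported functions.\<close>

definition root_lattice :: "nat \<Rightarrow> (nat \<Rightarrow>\<^sub>0 int) set" where
  "root_lattice n = {x. Poly_Mapping.keys x \<subseteq> {0..n + 1}}"

abbreviation \<alpha> :: "nat \<Rightarrow> (nat \<Rightarrow>\<^sub>0 int)" where
  "\<alpha> i \<equiv> frag_of i"

definition exps_root :: "nat \<Rightarrow> exps \<Rightarrow> (nat \<Rightarrow>\<^sub>0 int)" where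
  "exps_root n e =
     (let x = vL e; y = vR e in
      (\<Sum>i \<in> I n - {2, n - 1}. frag_cmul (int (fq e i) - int (fp e i)) (\<alpha> i))
      - frag_cmul (int (tp x)) (\<alpha> 0)
      + frag_cmul (int (tq x)) (\<alpha> 0 + \<alpha> 1 + frag_cmul 2 (\<alpha> 2) + \<alpha> 3)
      + frag_cmul (int (tr x)) (\<alpha> 0)
      + frag_cmul (int (ts x)) (\<alpha> 0 + \<alpha> 2)
      - frag_cmul (int (tt x)) (\<alpha> 2)
      + frag_cmul (int (tu x)) (\<alpha> 1 + \<alpha> 2 + \<alpha> 3)
      - frag_cmul (int (tp y)) (\<alpha> (n + 1))
      + frag_cmul (int (tq y)) (\<alpha> (n - 2) + frag_cmul 2 (\<alpha> (n - 1)) + \<alpha> n + \<alpha> (n + 1))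
      + frag_cmul (int (tr y)) (\<alpha> (n + 1))
      + frag_cmul (int (ts y)) (\<alpha> (n - 1) + \<alpha> (n + 1))
      - frag_cmul (int (tt y)) (\<alpha> (n - 1))
      + frag_cmul (int (tu y)) (\<alpha> (n - 2) + \<alpha> (n - 1) + \<alpha> n))"

text \<open>For \<open>n \<ge> 5\<close> and \<open>m \<in> monomials n\<close> the expression \<open>e\<close> exists and is unique.\<close>

definition G :: "nat \<Rightarrow> monomial \<Rightarrow> (nat \<Rightarrow>\<^sub>0 int)" where
  "G n m = exps_root n (THE e. expresses n m e)"

definition G' :: "nat \<Rightarrow> monomial \<Rightarrow> (nat \<Rightarrow>\<^sub>0 int)" where
  "G' n = restrict (G n) (reduced_monomials n)"

end

theory Submission
  imports Defs
begin

text \<open>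
  A reduced monomial is one in which no \<open>F\<^sub>i\<close> is used, so its exponent data are the
  \<^emph>\<open>normal\<close> ones, with all \<open>a\<^sub>i = 0\<close>. The set of normal exponent data is mapped bijectively
  onto the reduced monomials (\<open>bij_betw_exps_monomial\<close>) and bijectively onto the root lattice
  (\<open>bij_betw_exps_root\<close>), and \<open>G'\<close> carries the image of a datum under the first map to its
  image under the second (\<open>G'_exps_monomial\<close>). Divisibility by \<open>F\<^sub>i\<close> is immediate when
  \<open>a\<^sub>i \<noteq> 0\<close>, so the uniqueness of the expression of a reduced monomial is the injectivity of the first map.

  Both bijections are local problems at the vertices. At a vertex other than \<open>2\<close> and \<open>n - 1\<close>, a
  pair \<open>(p, q)\<close> of naturals with a zero entry is the same as the integer \<open>q - p\<close>. At a
  trivalent vertex, the condition on \<open>(p, \<dots>, u)\<close> says that in the cyclic order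
  \<open>p, u, q, s, r, t\<close> at most two exponents are nonzero, and then neighbours. So the admissible data are the
  lattice points of a fan of six cones glued in a circle. Sending the six generators to
  \<open>(0,1,1),  (0,0,1),  (1,0,1),  (1,0,0),  (1,1,0),  (0,1,0)\<close>
  (the exponents of \<open>A\<close>, \<open>B\<close>, \<open>C\<close>) identifies the fan with the points of \<open>\<nat>\<^sup>3\<close> that
  have a zero coordinate, which are the local monomials not divisible by \<open>ABC\<close>. Sending them to
  \<open>(-1,0),  (0,1),  (1,2),  (1,1),  (1,0),  (0,-1)\<close>
  (the coefficients at \<open>\<alpha>\<^sub>0\<close> and \<open>\<alpha>\<^sub>2\<close>, or at \<open>\<alpha>\<^sub>n\<^sub>+\<^sub>1\<close> and \<open>\<alpha>\<^sub>n\<^sub>-\<^sub>1\<close>) identifies it with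
  \<open>\<int>\<^sup>2\<close>, because neighbouring vectors form a basis and the six cones go around the plane once.

  In the root lattice the vertices interact, but only in a triangular way: the coefficients at
  \<open>\<alpha>\<^sub>0, \<alpha>\<^sub>2, \<alpha>\<^sub>n\<^sub>-\<^sub>1, \<alpha>\<^sub>n\<^sub>+\<^sub>1\<close> determine the data at the two trivalent vertices. Once these are known,
  their contribution to any other \<open>\<alpha>\<^sub>i\<close> is subtracted, and what remains is \<open>q\<^sub>i - p\<^sub>i\<close>.
\<close>

section \<open>Exponents at a trivalent vertex\<close>

lemma at_most_one_nonzero_pair: "at_most_one_nonzero [a, b] \<longleftrightarrow> a = 0 \<or> b = 0"
  by (auto simp: at_most_one_nonzero_def)

lemma at_most_one_nonzero_triple:
  "at_most_one_nonzero [a, b, c] \<longleftrightarrow> (a = 0 \<and> b = 0) \<or> (a = 0 \<and> c = 0) \<or> (b = 0 \<and> c = 0)"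
  by (auto simp: at_most_one_nonzero_def)

lemmas trivalent_ok_iff =
  trivalent_ok_def at_most_one_nonzero_pair at_most_one_nonzero_triple

definition abc_exponents :: "trivalent_exps \<Rightarrow> nat \<times> nat \<times> nat" where
  "abc_exponents x = (tq x + tr x + ts x, tp x + tr x + tt x, tp x + tq x + tu x)"

text \<open>
  The coefficients at \<open>\<alpha>\<^sub>0\<close> and \<open>\<alpha>\<^sub>2\<close>, equally those at \<open>\<alpha>\<^sub>n\<^sub>+\<^sub>1\<close> and \<open>\<alpha>\<^sub>n\<^sub>-\<^sub>1\<close>: these are
  the coefficients to which only one vertex contributes.
\<close>

definition trivalent_weight :: "trivalent_exps \<Rightarrow> int \<times> int" where
  "trivalent_weight x =
     (int (tq x) + int (tr x) + int (ts x) - int (tp x),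
      2 * int (tq x) + int (ts x) + int (tu x) - int (tt x))"

text \<open>
  The six cones, in three pairs. The pairs belong to \<open>c\<close>, \<open>b\<close> and \<open>a\<close>, in this order, being
  the indeterminate that is absent from the monomial, and subdivide the quadrant of exponents
  of the other two along its diagonal.
\<close>

lemma trivalent_ok_cones:
  assumes "trivalent_ok x"
  shows "(tp x = 0 \<and> tq x = 0 \<and> tu x = 0 \<and> (ts x = 0 \<or> tt x = 0))
       \<or> (tp x = 0 \<and> tr x = 0 \<and> tt x = 0 \<and> (ts x = 0 \<or> tu x = 0))
       \<or> (tq x = 0 \<and> tr x = 0 \<and> ts x = 0 \<and> (tt x = 0 \<or> tu x = 0))"
  using assms unfolding trivalent_ok_iff by linarith

text \<open>
  In a monomial without \<open>c\<close>, as many factors as possible are collected in \<open>ab\<close>, since \<open>s\<close> and \<open>t\<close>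
  are not both nonzero; hence \<open>r = min a b\<close>, while \<open>min a c\<close> and \<open>min b c\<close> vanish. Written with
  all three minima the formula is symmetric and covers the six cones at once.
\<close>

lemma trivalent_exps_formula_from_abc:
  assumes "trivalent_ok x" and "abc_exponents x = (a, b, c)"
  shows "x = \<lparr>tp = min b c, tq = min a c, tr = min a b,
              ts = a - min a c - min a b, tt = b - min b c - min a b, tu = c - min b c - min a c\<rparr>"
    and "min a (min b c) = 0"
proof -
  have abc: "a = tq x + tr x + ts x" "b = tp x + tr x + tt x" "c = tp x + tq x + tu x"
    using assms(2) by (auto simp: abc_exponents_def)
  show "x = \<lparr>tp = min b c, tq = min a c, tr = min a b,
              ts = a - min a c - min a b, tt = b - min b c - min a b, tu = c - min b c - min a c\<rparr>"
    and "min a (min b c) = 0"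
    using trivalent_ok_cones[OF assms(1)] unfolding abc
    by (cases x; elim disjE conjE; simp)+
qed

lemma trivalent_exps_from_abc:
  assumes "min a (min b c) = 0"
  obtains x where "trivalent_ok x" and "abc_exponents x = (a, b, c)"
proof
  let ?x = "\<lparr>tp = min b c, tq = min a c, tr = min a b,
              ts = a - min a c - min a b, tt = b - min b c - min a b, tu = c - min b c - min a c\<rparr>"
  show "trivalent_ok ?x" "abc_exponents ?x = (a, b, c)"
    using assms by (auto simp: trivalent_ok_iff abc_exponents_def min_def split: if_splits)
qed

text \<open>
  Each of the six expressions is the piecewise linear coordinate function of its generator: on the two cones
  that contain the generator it is the respective argument of \<open>min\<close>, and elsewhere it is not positive,
  so that truncation makes it zero. For \<open>p\<close> and \<open>t\<close> the two linear pieces agree.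
\<close>

lemma trivalent_exps_formula_from_weight:
  assumes "trivalent_ok x" and "trivalent_weight x = (a, b)"
  shows "x = \<lparr>tp = nat (- a), tq = nat (min a (b - a)), tr = nat (min a (a - b)),
              ts = nat (min b (2 * a - b)), tt = nat (- b), tu = nat (min b (b - 2 * a))\<rparr>"
proof -
  have ab: "a = int (tq x) + int (tr x) + int (ts x) - int (tp x)"
    "b = 2 * int (tq x) + int (ts x) + int (tu x) - int (tt x)"
    using assms(2) by (auto simp: trivalent_weight_def)
  show ?thesis
    using trivalent_ok_cones[OF assms(1)] unfolding ab
    by (cases x; elim disjE conjE; simp)
qed

lemma trivalent_exps_from_weight:
  obtains x where "trivalent_ok x" and "trivalent_weight x = (a, b)"
proof
  let ?x = "\<lparr>tp = nat (- a), tq = nat (min a (b - a)), tr = nat (min a (a - b)),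
              ts = nat (min b (2 * a - b)), tt = nat (- b), tu = nat (min b (b - 2 * a))\<rparr>"
  \<comment> \<open>the images of the six cones cover the plane\<close>
  consider "a \<le> 0" "b \<le> 0" | "a \<le> 0" "0 \<le> b" | "0 \<le> a" "b \<le> 0"
    | "0 \<le> b" "b \<le> a" | "a \<le> b" "b \<le> 2 * a" | "0 \<le> a" "2 * a \<le> b"
    by linarith
  then have "trivalent_ok ?x \<and> trivalent_weight ?x = (a, b)"
    by cases (simp_all add: trivalent_ok_iff trivalent_weight_def min_absorb1 min_absorb2)
  then show "trivalent_ok ?x" "trivalent_weight ?x = (a, b)"
    by blast+
qed

section \<open>Monomials vertex by vertex\<close>

definition pvar :: "nat \<Rightarrow> nat \<Rightarrow> indet" where
  "pvar n i = (if i \<in> I0 n then (i, 3) else (i, 2))"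

definition qvar :: "nat \<Rightarrow> nat \<Rightarrow> indet" where
  "qvar n i = (if i \<in> I0 n then (i, 1) else (i, 4))"

text \<open>
  The part of a monomial at one vertex, in a form that does not depend on the parity of \<open>n\<close> or of \<open>i\<close>.
  The indeterminates of different vertices are different, so the vertices can be treated one at a time.
\<close>

definition vertex_monomial :: "nat \<Rightarrow> exps \<Rightarrow> nat \<Rightarrow> monomial" where
  "vertex_monomial n e i = repeat_mset (fa e i) (F n i) +
     (if i = 2 then trivalent_monomial (varA n) (varB n) (varC n) (vL e)
      else if i = n - 1 then trivalent_monomial (varA' n) (varB' n) (varC' n) (vR e)
      else repeat_mset (fp e i) {#pvar n i#} + repeat_mset (fq e i) {#qvar n i#})"

lemmas vars_defs = varA_def varB_def varC_def varA'_def varB'_def varC'_def pvar_def qvar_def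

lemma I_split:
  assumes "n \<ge> 5"
  shows "(I0 n - {2, n - 1}) \<inter> (I1 n - {2}) = {}"
    and "n - 1 \<in> I0 n" and "n - 1 \<notin> I1 n" and "I n - {2, n - 1} = (I0 n - {2, n - 1}) \<union> (I1 n - {2})"
  using assms by (auto simp: I_def I0_def I1_def)

lemma exps_monomial_eq_sum:
  assumes "n \<ge> 5"
  shows "exps_monomial n e = (\<Sum>i \<in> I n. vertex_monomial n e i)"
proof -
  let ?L = "trivalent_monomial (varA n) (varB n) (varC n) (vL e)"
  let ?R = "trivalent_monomial (varA' n) (varB' n) (varC' n) (vR e)"
  let ?h = "\<lambda>i. if i = 2 then ?L else if i = n - 1 then ?R
      else repeat_mset (fp e i) {#pvar n i#} + repeat_mset (fq e i) {#qvar n i#}"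
  have fin: "finite (I n)" "finite (I0 n)" "finite (I1 n)"
    by (auto simp: I_def I0_def I1_def)
  have "(\<Sum>i \<in> I n. ?h i) = (\<Sum>i \<in> {2, n - 1}. ?h i) + (\<Sum>i \<in> I n - {2, n - 1}. ?h i)"
    using assms fin by (subst sum.subset_diff[of "{2, n - 1}"]) (auto simp: I_def add.commute)
  also have "(\<Sum>i \<in> I n - {2, n - 1}. ?h i) =
      (\<Sum>i \<in> I0 n - {2, n - 1}. ?h i) + (\<Sum>i \<in> I1 n - {2}. ?h i)"
    unfolding I_split(4)[OF assms] by (rule sum.union_disjoint) (use fin I_split(1)[OF assms] in auto)
  also have "(\<Sum>i \<in> {2, n - 1}. ?h i) = ?L + ?R"
    using assms by auto
  also have "(\<Sum>i \<in> I0 n - {2, n - 1}. ?h i) =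
      (\<Sum>i \<in> I0 n - {2, n - 1}. repeat_mset (fp e i) {#(i, 3)#} + repeat_mset (fq e i) {#(i, 1)#})"
    by (intro sum.cong) (auto simp: pvar_def qvar_def)
  also have "(\<Sum>i \<in> I1 n - {2}. ?h i) =
      (\<Sum>j \<in> I1 n - {2}. repeat_mset (fp e j) {#(j, 2)#} + repeat_mset (fq e j) {#(j, 4)#})"
    using I_split(1,3)[OF assms] by (intro sum.cong) (auto simp: pvar_def qvar_def)
  finally show ?thesis
    by (simp add: exps_monomial_def vertex_monomial_def sum.distrib add_ac)
qed

lemma F_trivalent:
  assumes "n \<ge> 5"
  shows "F n 2 = {#varA n, varB n, varC n#}" and "F n (n - 1) = {#varA' n, varB' n, varC' n#}"
  using assms by (auto simp: F_def)

lemma F_bivalent: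
  assumes "i \<notin> {2, n - 1}"
  shows "F n i = {#qvar n i, pvar n i#}"
  using assms by (auto simp: F_def pvar_def qvar_def)

lemma set_trivalent_monomial: "v \<in># trivalent_monomial a b c x \<Longrightarrow> v \<in> {a, b, c}"
  by (auto simp: trivalent_monomial_def split: if_splits)

lemma set_repeat_mset: "v \<in># repeat_mset k A \<Longrightarrow> v \<in># A"
  by (metis count_repeat_mset mult_0_right not_in_iff)

lemma set_vertex_monomial: "v \<in># vertex_monomial n e i \<Longrightarrow> fst v = i"
proof -
  assume v: "v \<in># vertex_monomial n e i"
  have F: "w \<in># F n i \<Longrightarrow> fst w = i" for w
    by (auto simp: F_def vars_defs split: if_splits)
  consider "v \<in># F n i" | "i = 2" "v \<in># trivalent_monomial (varA n) (varB n) (varC n) (vL e)"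
    | "i = n - 1" "v \<in># trivalent_monomial (varA' n) (varB' n) (varC' n) (vR e)"
    | "v \<in> {pvar n i, qvar n i}"
    using v unfolding vertex_monomial_def
    by (auto split: if_split_asm dest: set_repeat_mset)
  then show ?thesis
  proof cases
    case 2
    from set_trivalent_monomial[OF this(2)] this(1) show ?thesis by (auto simp: vars_defs)
  next
    case 3
    from set_trivalent_monomial[OF this(2)] this(1) show ?thesis by (auto simp: vars_defs)
  qed (auto simp: F pvar_def qvar_def)
qed

lemma count_exps_monomial:
  assumes "n \<ge> 5"
  shows "count (exps_monomial n e) v =
           (if fst v \<in> I n then count (vertex_monomial n e (fst v)) v else 0)"
proof -
  have "count (exps_monomial n e) v = (\<Sum>i \<in> I n. count (vertex_monomial n e i) v)"
    by (simp add: exps_monomial_eq_sum[OF assms] count_sum)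
  also have "\<dots> = (\<Sum>i \<in> I n. if i = fst v then count (vertex_monomial n e (fst v)) v else 0)"
  proof (intro sum.cong refl)
    fix i
    show "count (vertex_monomial n e i) v
        = (if i = fst v then count (vertex_monomial n e (fst v)) v else 0)"
      using set_vertex_monomial[of v n e i] by (cases "v \<in># vertex_monomial n e i") (auto simp: not_in_iff)
  qed
  finally show ?thesis by (simp add: I_def)
qed

text \<open>
  For \<open>n\<close> odd the vertex \<open>2\<close> is in \<open>I0 n\<close>, for \<open>n\<close> even it is in \<open>I1 n\<close>; in either case it
  contributes the indeterminates \<open>A, B, C\<close>. The vertex \<open>n - 1\<close> is always in \<open>I0 n\<close>.
\<close>

lemma V_eq:
  assumes "n \<ge> 5"
  shows "V n = {varA n, varB n, varC n, varA' n, varB' n, varC' n}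
             \<union> (\<Union>i \<in> I n - {2, n - 1}. {pvar n i, qvar n i})"
  (is "_ = ?T \<union> ?U")
proof -
  let ?f = "\<lambda>i :: nat. {(i, 1), (i, 3 :: nat)}" and ?g = "\<lambda>j :: nat. {(j, 2), (j, 4 :: nat)}"
  have U0: "(\<Union>i \<in> I0 n - {2, n - 1}. {pvar n i, qvar n i}) = (\<Union>i \<in> I0 n - {2, n - 1}. ?f i)"
    by (intro SUP_cong) (auto simp: pvar_def qvar_def)
  have U1: "(\<Union>j \<in> I1 n - {2}. {pvar n j, qvar n j}) = (\<Union>j \<in> I1 n - {2}. ?g j)"
    using I_split(1,3)[OF assms] by (intro SUP_cong) (auto simp: pvar_def qvar_def)
  define X Y where "X = (\<Union>i \<in> I0 n - {2, n - 1}. ?f i)" and "Y = (\<Union>j \<in> I1 n - {2}. ?g j)"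
  have U: "?U = X \<union> Y"
    unfolding I_split(4)[OF assms] UN_Un U0 U1 X_def Y_def ..
  have two: "2 \<in> I0 n \<longleftrightarrow> odd n" "2 \<in> I1 n \<longleftrightarrow> even n"
    using assms by (auto simp: I0_def I1_def I_def)
  show ?thesis
  proof (cases "odd n")
    case True
    have "(\<Union>i \<in> I0 n. ?f i) = ?f 2 \<union> ?f (n - 1) \<union> X" "(\<Union>j \<in> I1 n. ?g j) = Y"
      using two True I_split(2)[OF assms] unfolding X_def Y_def by blast+
    with True show ?thesis
      unfolding U V_def by (auto simp: vars_defs)
  next
    case False
    have "(\<Union>i \<in> I0 n. ?f i) = ?f (n - 1) \<union> X" "(\<Union>j \<in> I1 n. ?g j) = ?g 2 \<union> Y"
      using two False I_split(2)[OF assms] unfolding X_def Y_def by blast+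
    with False show ?thesis
      unfolding U V_def by (auto simp: vars_defs)
  qed
qed

section \<open>Normal exponents and reduced monomials\<close>

definition normal_exps :: "nat \<Rightarrow> exps set" where
  "normal_exps n = {e. exps_ok n e \<and> fa e = (\<lambda>_. 0)}"

text \<open>
  With \<open>fa e = 0\<close> the exponents of \<open>exps_monomial n e\<close> at each vertex see only the data of that
  vertex; this reduces the comparison with reduced monomials to the local bijections.
\<close>

lemma count_normal_exps:
  assumes "n \<ge> 5" and "e \<in> normal_exps n"
  defines "m \<equiv> exps_monomial n e"
  shows "(count m (varA n), count m (varB n), count m (varC n)) = abc_exponents (vL e)"
    and "(count m (varA' n), count m (varB' n), count m (varC' n)) = abc_exponents (vR e)"
    and "i \<in> I n - {2, n - 1} \<Longrightarrow> count m (pvar n i) = fp e i"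
    and "i \<in> I n - {2, n - 1} \<Longrightarrow> count m (qvar n i) = fq e i"
  using assms(1,2) unfolding m_def
  by (auto simp: count_exps_monomial normal_exps_def vertex_monomial_def trivalent_monomial_def
      abc_exponents_def vars_defs I_def)

lemma multiset_pair_subseteq:
  assumes "a \<noteq> b"
  shows "{#a, b#} \<subseteq># m \<longleftrightarrow> 0 < count m a \<and> 0 < count m b"
proof -
  have "count {#a, b#} x = (if x = a \<or> x = b then 1 else 0)" for x
    using assms by simp
  then show ?thesis
    unfolding subseteq_mset_def by (metis Suc_le_eq One_nat_def le0)
qed

lemma multiset_triple_subseteq:
  assumes "a \<noteq> b" and "a \<noteq> c" and "b \<noteq> c"
  shows "{#a, b, c#} \<subseteq># m \<longleftrightarrow> 0 < count m a \<and> 0 < count m b \<and> 0 < count m c"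
proof -
  have "count {#a, b, c#} x = (if x = a \<or> x = b \<or> x = c then 1 else 0)" for x
    using assms by simp
  then show ?thesis
    unfolding subseteq_mset_def by (metis Suc_le_eq One_nat_def le0)
qed

lemma reduced_monomials_iff:
  assumes "n \<ge> 5"
  shows "m \<in> reduced_monomials n \<longleftrightarrow> set_mset m \<subseteq> V n
     \<and> min (count m (varA n)) (min (count m (varB n)) (count m (varC n))) = 0
     \<and> min (count m (varA' n)) (min (count m (varB' n)) (count m (varC' n))) = 0
     \<and> (\<forall>i \<in> I n - {2, n - 1}. count m (pvar n i) = 0 \<or> count m (qvar n i) = 0)"
proof -
  have "2 \<in> I n" "n - 1 \<in> I n"
    using assms by (auto simp: I_def)
  then have I: "(\<forall>i \<in> I n. P i) \<longleftrightarrow> P 2 \<and> P (n - 1) \<and> (\<forall>i \<in> I n - {2, n - 1}. P i)" for P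
    by blast
  have two: "\<not> F n 2 \<subseteq># m
      \<longleftrightarrow> min (count m (varA n)) (min (count m (varB n)) (count m (varC n))) = 0"
  proof -
    have "varA n \<noteq> varB n" "varA n \<noteq> varC n" "varB n \<noteq> varC n"
      by (simp_all add: vars_defs)
    note triple = multiset_triple_subseteq[OF this]
    show ?thesis
      unfolding F_trivalent[OF assms] triple by arith
  qed
  have last: "\<not> F n (n - 1) \<subseteq># m
      \<longleftrightarrow> min (count m (varA' n)) (min (count m (varB' n)) (count m (varC' n))) = 0"
  proof -
    have "varA' n \<noteq> varB' n" "varA' n \<noteq> varC' n" "varB' n \<noteq> varC' n"
      by (simp_all add: vars_defs)
    note triple = multiset_triple_subseteq[OF this]
    show ?thesis
      unfolding F_trivalent[OF assms] triple by arith
  qed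
  have mid: "\<not> F n i \<subseteq># m \<longleftrightarrow> count m (pvar n i) = 0 \<or> count m (qvar n i) = 0"
    if "i \<in> I n - {2, n - 1}" for i
  proof -
    have "i \<notin> {2, n - 1}" using that by blast
    have ne: "qvar n i \<noteq> pvar n i" by (simp add: pvar_def qvar_def)
    show ?thesis
      unfolding F_bivalent[OF \<open>i \<notin> {2, n - 1}\<close>] multiset_pair_subseteq[OF ne] by arith
  qed
  have bivalent: "(\<forall>i \<in> I n - {2, n - 1}. \<not> F n i \<subseteq># m)
      \<longleftrightarrow> (\<forall>i \<in> I n - {2, n - 1}. count m (pvar n i) = 0 \<or> count m (qvar n i) = 0)"
    by (intro ball_cong refl mid)
  show ?thesis
    unfolding reduced_monomials_def monomials_def mem_Collect_eq I two last bivalent ..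
qed

lemma exps_eqI:
  assumes "e \<in> normal_exps n" and "e' \<in> normal_exps n" and "vL e = vL e'" and "vR e = vR e'"
    and "\<And>i. i \<in> I n - {2, n - 1} \<Longrightarrow> fp e i = fp e' i \<and> fq e i = fq e' i"
  shows "e = e'"
proof -
  have "fp e i = fp e' i \<and> fq e i = fq e' i" for i
    using assms(1,2) assms(5)[of i] by (cases "i \<in> I n - {2, n - 1}") (auto simp: normal_exps_def exps_ok_def)
  then have "fp e = fp e'" "fq e = fq e'" by auto
  with assms show ?thesis by (simp add: normal_exps_def)
qed

lemma normal_exps_obtain:
  assumes "trivalent_ok x" and "trivalent_ok y"
    and "\<And>i. i \<in> I n - {2, n - 1} \<Longrightarrow> p i = 0 \<or> q i = 0"
  obtains e where "e \<in> normal_exps n" and "vL e = x" and "vR e = y"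
    and "\<And>i. i \<in> I n - {2, n - 1} \<Longrightarrow> fp e i = p i"
    and "\<And>i. i \<in> I n - {2, n - 1} \<Longrightarrow> fq e i = q i"
proof
  let ?c = "\<lambda>f i. if i \<in> I n - {2, n - 1} then f i else (0 :: nat)"
  let ?e = "\<lparr>fa = (\<lambda>_. 0), fp = ?c p, fq = ?c q, vL = x, vR = y\<rparr>"
  show "?e \<in> normal_exps n"
    using assms by (auto simp: normal_exps_def exps_ok_def at_most_one_nonzero_pair)
qed auto

lemma exps_monomial_mem_monomials:
  assumes "n \<ge> 5"
  shows "exps_monomial n e \<in> monomials n"
proof -
  have "v \<in> V n" if i: "i \<in> I n" and v: "v \<in># vertex_monomial n e i" for v i
  proof -
    consider (two) "i = 2" | (last) "i = n - 1" "i \<noteq> 2" | (mid) "i \<notin> {2, n - 1}" by blast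
    then show ?thesis
    proof cases
      case two
      then have "v \<in># F n 2 \<or> v \<in># trivalent_monomial (varA n) (varB n) (varC n) (vL e)"
        using v unfolding vertex_monomial_def by (auto dest: set_repeat_mset)
      then show ?thesis
        unfolding F_trivalent(1)[OF assms] V_eq[OF assms] by (auto dest: set_trivalent_monomial)
    next
      case last
      then have "v \<in># F n (n - 1) \<or> v \<in># trivalent_monomial (varA' n) (varB' n) (varC' n) (vR e)"
        using v unfolding vertex_monomial_def by (auto dest: set_repeat_mset)
      then show ?thesis
        unfolding F_trivalent(2)[OF assms] V_eq[OF assms] by (auto dest: set_trivalent_monomial)
    next
      case mid
      then have "v \<in> {pvar n i, qvar n i}"
        using v F_bivalent[OF mid] unfolding vertex_monomial_def
        by (auto dest!: set_repeat_mset split: if_split_asm)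
      then show ?thesis
        using i mid unfolding V_eq[OF assms] by blast
    qed
  qed
  then show ?thesis
    by (auto simp: monomials_def exps_monomial_eq_sum[OF assms] set_mset_sum I_def)
qed

text \<open>
  A monomial and a normal datum are both families of independent local data, so the inverse map is
  assembled from the local inverses, and the reducedness condition at each vertex is what the local
  inverse needs.
\<close>

lemma bij_betw_exps_monomial:
  assumes "n \<ge> 5"
  shows "bij_betw (exps_monomial n) (normal_exps n) (reduced_monomials n)"
  unfolding bij_betw_def
proof
  note count = count_normal_exps[OF assms]
  show "inj_on (exps_monomial n) (normal_exps n)"
  proof
    fix e e'
    assume e: "e \<in> normal_exps n" and e': "e' \<in> normal_exps n"
      and eq: "exps_monomial n e = exps_monomial n e'"
    have ok: "trivalent_ok (vL e)" "trivalent_ok (vL e')" "trivalent_ok (vR e)" "trivalent_ok (vR e')"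
      using e e' by (auto simp: normal_exps_def exps_ok_def)
    show "e = e'"
    proof (rule exps_eqI[OF e e'])
      show "vL e = vL e'"
        using trivalent_exps_formula_from_abc(1)[OF ok(1) count(1)[OF e, symmetric]]
          trivalent_exps_formula_from_abc(1)[OF ok(2) count(1)[OF e', symmetric]] eq by simp
      show "vR e = vR e'"
        using trivalent_exps_formula_from_abc(1)[OF ok(3) count(2)[OF e, symmetric]]
          trivalent_exps_formula_from_abc(1)[OF ok(4) count(2)[OF e', symmetric]] eq by simp
    qed (use eq count(3,4)[OF e] count(3,4)[OF e'] in auto)
  qed
  show "exps_monomial n ` normal_exps n = reduced_monomials n"
  proof (intro equalityI subsetI)
    fix m assume "m \<in> exps_monomial n ` normal_exps n"
    then obtain e where e: "e \<in> normal_exps n" and m: "m = exps_monomial n e" by auto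
    have ok: "trivalent_ok (vL e)" "trivalent_ok (vR e)"
      "\<forall>i \<in> I n - {2, n - 1}. fp e i = 0 \<or> fq e i = 0"
      using e by (auto simp: normal_exps_def exps_ok_def at_most_one_nonzero_pair)
    show "m \<in> reduced_monomials n"
      unfolding reduced_monomials_iff[OF assms]
      using trivalent_exps_formula_from_abc(2)[OF ok(1) count(1)[OF e, symmetric]]
        trivalent_exps_formula_from_abc(2)[OF ok(2) count(2)[OF e, symmetric]]
        ok(3) count(3,4)[OF e] exps_monomial_mem_monomials[OF assms, of e]
      unfolding m monomials_def by simp
  next
    fix m assume "m \<in> reduced_monomials n"
    note m = this[unfolded reduced_monomials_iff[OF assms]]
    obtain x where x: "trivalent_ok x"
      "abc_exponents x = (count m (varA n), count m (varB n), count m (varC n))"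
      using m trivalent_exps_from_abc by metis
    obtain y where y: "trivalent_ok y"
      "abc_exponents y = (count m (varA' n), count m (varB' n), count m (varC' n))"
      using m trivalent_exps_from_abc by metis
    obtain e where e: "e \<in> normal_exps n" "vL e = x" "vR e = y"
      "\<And>i. i \<in> I n - {2, n - 1} \<Longrightarrow> fp e i = count m (pvar n i)"
      "\<And>i. i \<in> I n - {2, n - 1} \<Longrightarrow> fq e i = count m (qvar n i)"
      using normal_exps_obtain[OF x(1) y(1), of n "\<lambda>i. count m (pvar n i)" "\<lambda>i. count m (qvar n i)"] m
      by metis
    have "count (exps_monomial n e) v = count m v" if "v \<in> V n" for v
      using that count[OF e(1)] unfolding V_eq[OF assms] e(2,3) x(2) y(2)
      by (auto simp: e(4,5))
    moreover have "count (exps_monomial n e) v = count m v" if "v \<notin> V n" for v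
      using that m exps_monomial_mem_monomials[OF assms, of e]
      unfolding monomials_def by (metis (no_types, lifting) count_eq_zero_iff mem_Collect_eq subsetD)
    ultimately have "m = exps_monomial n e" by (metis multiset_eqI)
    with e(1) show "m \<in> exps_monomial n ` normal_exps n" by blast
  qed
qed

text \<open>
  A nonzero \<open>a\<^sub>i\<close> makes the monomial divisible by \<open>F\<^sub>i\<close>. Hence the competitors for the unique
  expression of a reduced monomial are all normal.
\<close>

lemma normal_exps_if_reduced:
  assumes "n \<ge> 5" and "exps_ok n e" and "exps_monomial n e \<in> reduced_monomials n"
  shows "e \<in> normal_exps n"
proof -
  have "fa e i = 0" for i
  proof (rule ccontr)
    assume nz: "fa e i \<noteq> 0"
    then have i: "i \<in> I n" using assms(2) by (auto simp: exps_ok_def)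
    have "F n i \<subseteq># repeat_mset (fa e i) (F n i)"
      using nz by (cases "fa e i") auto
    also have "\<dots> \<subseteq># vertex_monomial n e i" by (simp add: vertex_monomial_def)
    also have "\<dots> \<subseteq># exps_monomial n e"
      unfolding exps_monomial_eq_sum[OF assms(1)]
      by (subst sum.remove[of "I n" i]) (use i in \<open>auto simp: I_def\<close>)
    finally show False using assms(3) i by (auto simp: reduced_monomials_def)
  qed
  then show ?thesis using assms(2) by (auto simp: normal_exps_def)
qed

lemma G'_exps_monomial:
  assumes "n \<ge> 5" and "e \<in> normal_exps n"
  shows "G' n (exps_monomial n e) = exps_root n e"
proof -
  let ?m = "exps_monomial n e"
  have m: "?m \<in> reduced_monomials n"
    using bij_betw_exps_monomial[OF assms(1)] assms(2) by (auto simp: bij_betw_def)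
  have "(THE e'. expresses n ?m e') = e"
  proof (rule the_equality)
    show "expresses n ?m e" using assms(2) by (simp add: expresses_def normal_exps_def)
    fix e' assume "expresses n ?m e'"
    then have ok: "exps_ok n e'" and eq: "?m = exps_monomial n e'" by (auto simp: expresses_def)
    with m have "e' \<in> normal_exps n" using normal_exps_if_reduced[OF assms(1)] by simp
    then show "e' = e"
      using bij_betw_exps_monomial[OF assms(1)] assms(2) eq by (auto simp: bij_betw_def dest: inj_onD)
  qed
  then show ?thesis using m by (simp add: G'_def G_def)
qed

section \<open>Coefficients in the root lattice\<close>

text \<open>
  What the data \<open>x\<close> at \<open>2\<close> and \<open>y\<close> at \<open>n - 1\<close> contribute to the coefficient at \<open>\<alpha>\<^sub>i\<close> for
  \<open>i \<in> I n - {2, n - 1}\<close>. The two contributions are added, not alternatives: for \<open>n = 5\<close> both vertices have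
  the neighbour \<open>3 = n - 2\<close>.
\<close>

definition alpha_correction :: "nat \<Rightarrow> trivalent_exps \<Rightarrow> trivalent_exps \<Rightarrow> nat \<Rightarrow> int" where
  "alpha_correction n x y i = (if i = 1 \<or> i = 3 then int (tq x) + int (tu x) else 0)
     + (if i = n - 2 \<or> i = n then int (tq y) + int (tu y) else 0)"

lemma lookup_exps_root:
  assumes "n \<ge> 5"
  defines "L \<equiv> \<lambda>e. Poly_Mapping.lookup (exps_root n e)"
  shows "(L e 0, L e 2) = trivalent_weight (vL e)"
    and "(L e (n + 1), L e (n - 1)) = trivalent_weight (vR e)"
    and "i \<in> I n - {2, n - 1} \<Longrightarrow> L e i = int (fq e i) - int (fp e i) + alpha_correction n (vL e) (vR e) i"
    and "i \<notin> {0..n + 1} \<Longrightarrow> L e i = 0"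
proof -
  have sum: "Poly_Mapping.lookup (\<Sum>j \<in> J. frag_cmul (c j) (\<alpha> j)) i = (if i \<in> J then c i else 0)"
    if "finite J" for J c i
  proof -
    have "Poly_Mapping.lookup (\<Sum>j \<in> J. frag_cmul (c j) (\<alpha> j)) i = (\<Sum>j \<in> J. if j = i then c j else 0)"
      unfolding lookup_sum by (intro sum.cong) auto
    then show ?thesis using that by simp
  qed
  have fin: "finite (I n - {2, n - 1})" by (simp add: I_def)
  note L = L_def exps_root_def Let_def lookup_add lookup_minus lookup_frag_cmul lookup_frag_of sum[OF fin]
  have "0 \<notin> I n - {2, n - 1}" "2 \<notin> I n - {2, n - 1}" "n + 1 \<notin> I n - {2, n - 1}" "n - 1 \<notin> I n - {2, n - 1}"
    by (auto simp: I_def)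
  note notin = this
  \<comment> \<open>removes the truncated subtractions, so that all indices can be compared by simplification\<close>
  obtain k where k: "n = k + 5"
    using assms(1) by (metis add.commute le_Suc_ex)
  show "(L e 0, L e 2) = trivalent_weight (vL e)"
    unfolding L trivalent_weight_def using notin unfolding k by simp
  show "(L e (n + 1), L e (n - 1)) = trivalent_weight (vR e)"
    unfolding L trivalent_weight_def using notin unfolding k by simp
  show "L e i = int (fq e i) - int (fp e i) + alpha_correction n (vL e) (vR e) i"
    if i: "i \<in> I n - {2, n - 1}"
  proof -
    have "i \<noteq> 0" "i \<noteq> 2" "i \<noteq> n - 1" "i \<noteq> n + 1" "n \<noteq> n - 2"
      using i assms(1) by (auto simp: I_def)
    then show ?thesis
      unfolding L alpha_correction_def if_P[OF i] by (simp only: if_False) simp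
  qed
  show "L e i = 0" if "i \<notin> {0..n + 1}"
  proof -
    have "i \<notin> I n - {2, n - 1}" "i \<noteq> 0" "i \<noteq> 1" "i \<noteq> 2" "i \<noteq> 3"
      "i \<noteq> n - 2" "i \<noteq> n - 1" "i \<noteq> n" "i \<noteq> n + 1"
      using that assms(1) by (auto simp: I_def)
    then show ?thesis unfolding L by simp
  qed
qed

text \<open>
  The triangular elimination: the coefficients at \<open>0\<close>, \<open>2\<close>, \<open>n + 1\<close>, \<open>n - 1\<close> give the data at the
  trivalent vertices, and then \<open>alpha_correction\<close> is known at all remaining vertices.
\<close>

lemma bij_betw_exps_root:
  assumes "n \<ge> 5"
  shows "bij_betw (exps_root n) (normal_exps n) (root_lattice n)"
  unfolding bij_betw_def
proof
  note lookup = lookup_exps_root[OF assms]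
  show "inj_on (exps_root n) (normal_exps n)"
  proof
    fix e e'
    assume e: "e \<in> normal_exps n" and e': "e' \<in> normal_exps n" and eq: "exps_root n e = exps_root n e'"
    have ok: "trivalent_ok (vL e)" "trivalent_ok (vL e')" "trivalent_ok (vR e)" "trivalent_ok (vR e')"
      using e e' by (auto simp: normal_exps_def exps_ok_def)
    have L: "vL e = vL e'"
      using trivalent_exps_formula_from_weight[OF ok(1) lookup(1)[symmetric]]
        trivalent_exps_formula_from_weight[OF ok(2) lookup(1)[symmetric]] eq by simp
    have R: "vR e = vR e'"
      using trivalent_exps_formula_from_weight[OF ok(3) lookup(2)[symmetric]]
        trivalent_exps_formula_from_weight[OF ok(4) lookup(2)[symmetric]] eq by simp
    show "e = e'"
    proof (rule exps_eqI[OF e e' L R])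
      fix i assume i: "i \<in> I n - {2, n - 1}"
      have "fp e i = 0 \<or> fq e i = 0" "fp e' i = 0 \<or> fq e' i = 0"
        using i e e' by (auto simp: normal_exps_def exps_ok_def at_most_one_nonzero_pair)
      then show "fp e i = fp e' i \<and> fq e i = fq e' i"
        using lookup(3)[OF i, of e] lookup(3)[OF i, of e'] unfolding eq L R by linarith
    qed
  qed
  show "exps_root n ` normal_exps n = root_lattice n"
  proof (intro equalityI subsetI)
    fix z assume "z \<in> exps_root n ` normal_exps n"
    then obtain e where "z = exps_root n e" by blast
    then have "Poly_Mapping.lookup z i = 0" if "i \<notin> {0..n + 1}" for i
      using lookup(4) that by simp
    then show "z \<in> root_lattice n"
      unfolding root_lattice_def mem_Collect_eq by (meson in_keys_iff subsetI)
  next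
    fix z assume "z \<in> root_lattice n"
    then have supp: "Poly_Mapping.lookup z i = 0" if "i \<notin> {0..n + 1}" for i
      using that unfolding root_lattice_def mem_Collect_eq by (metis in_keys_iff subsetD)
    let ?z = "Poly_Mapping.lookup z"
    obtain x where x: "trivalent_ok x" "trivalent_weight x = (?z 0, ?z 2)"
      by (rule trivalent_exps_from_weight)
    obtain y where y: "trivalent_ok y" "trivalent_weight y = (?z (n + 1), ?z (n - 1))"
      by (rule trivalent_exps_from_weight)
    \<comment> \<open>\<open>c i\<close> is to become \<open>q\<^sub>i - p\<^sub>i\<close>\<close>
    define c where "c i = ?z i - alpha_correction n x y i" for i
    obtain e where e: "e \<in> normal_exps n" "vL e = x" "vR e = y"
      "\<And>i. i \<in> I n - {2, n - 1} \<Longrightarrow> fp e i = nat (- c i)"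
      "\<And>i. i \<in> I n - {2, n - 1} \<Longrightarrow> fq e i = nat (c i)"
      by (rule normal_exps_obtain[OF x(1) y(1), of n "\<lambda>i. nat (- c i)" "\<lambda>i. nat (c i)"]) auto
    have "Poly_Mapping.lookup (exps_root n e) i = ?z i" for i
    proof -
      consider "i \<in> {0, 2, n - 1, n + 1}" | "i \<in> I n - {2, n - 1}" | "i \<notin> {0..n + 1}"
      proof -
        have "i \<in> {0..n + 1} \<Longrightarrow> i = 0 \<or> i = n + 1 \<or> i \<in> I n"
          by (auto simp: I_def)
        with that show thesis by blast
      qed
      then show ?thesis
      proof cases
        case 1
        then show ?thesis using lookup(1,2)[of e] unfolding e(2,3) x(2) y(2) by auto
      next
        case 2
        then show ?thesis using lookup(3)[OF 2, of e] e by (auto simp: c_def)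
      next
        case 3
        then show ?thesis using lookup(4) supp by simp
      qed
    qed
    then have "z = exps_root n e" by (intro poly_mapping_eqI) simp
    with e(1) show "z \<in> exps_root n ` normal_exps n" by blast
  qed
qed

theorem proposition5p30:
  fixes n :: nat
  assumes "n \<ge> 5"
  shows "bij_betw (G' n) (reduced_monomials n) (root_lattice n)"
proof -
  have "bij_betw (G' n \<circ> exps_monomial n) (normal_exps n) (root_lattice n)"
    using bij_betw_exps_root[OF assms]
    by (subst bij_betw_cong[of _ _ "exps_root n"]) (simp_all add: G'_exps_monomial[OF assms])
  then show ?thesis
    using bij_betw_comp_iff[OF bij_betw_exps_monomial[OF assms]] by blast
qed

end
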